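(* Assume that $\mu$ satisfies (A1)--(A3). Let $\mathbf{u}^\star\in V$ be the unique minimiser of $\mathsf{E}$ in $V$ (equivalently, the unique solution of the weak problem), let $\mathbf{u}^0\in V$ be arbitrary, and let $\{\mathbf{u}^n\}_{n\ge 0}\subset V$ be the sequence generated by the Kačanov iteration. Then, for all $n\ge 0$, $$0\leq \mathsf{E}(\mathbf{u}^{n+1})-\mathsf{E}(\mathbf{u}^\star)\leq q(n)\left(\mathsf{E}(\mathbf{u}^n)-\mathsf{E}(\mathbf{u}^\star)\right),$$ where $$q(n):=1-\frac14\left\{\operatorname*{ess\,sup}_{\boldsymbol{x}\in\Omega}\frac{\mu(|\underline{e}(\mathbf{u}^n)|^2)}{\inf_{t\in(-1,1)}\xi'\left(\max\{0,|\underline{e}(\mathbf{u}^\star)|+t|\underline{e}(\mathbf{u}^n)-\underline{e}(\mathbf{u}^\star)|\}\right)}\right\}^{-1}$$ and $\xi(t)=\mu(t^2)t$ for $t\ge 0$ (with $\mu$, $\xi$, $\underline{e}(\mathbf{u}^n)$ and $\underline{e}(\mathbf{u}^\star)$ evaluated at the point $\boldsymbol{x}$ inside the essential supremum).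
   Context: Let $\Omega\subset\mathbb{R}^d$, $d\in\{2,3\}$, be a bounded Lipschitz domain and $\mathbf{f}\in \mathrm{L}^2(\Omega)^d$. For a vector field $\mathbf{u}$, $\underline{e}(\mathbf{u})$ is the $d\times d$ tensor with entries $e_{ij}(\mathbf{u})=\frac12\left(\frac{\partial u_i}{\partial x_j}+\frac{\partial u_j}{\partial x_i}\right)$; $|\cdot|$ denotes the Frobenius norm and $:$ the Frobenius inner product of $d\times d$ matrices. The viscosity $\mu=\mu(\boldsymbol{x},t)$ is real-valued and is assumed to satisfy: (A1) $\mu\in C(\overline\Omega\times\mathbb{R}_{\ge 0})$ and it is differentiable in the second variable; (A2) there exist constants $m_\mu,M_\mu>0$ such that $m_\mu(t-s)\le\mu(\boldsymbol{x},t^2)t-\mu(\boldsymbol{x},s^2)s\le M_\mu(t-s)$ for all $t\ge s\ge 0$ and $\boldsymbol{x}\in\overline\Omega$; (A3) $\mu$ is decreasing in the second variable, i.e. $\mu'(\boldsymbol{x},t)\le 0$ for all $t\ge 0$ and $\boldsymbol{x}\in\overline\Omega$. The prime denotes the derivative with respect to the second (scalar) variable, and the dependence of $\mu$ on $\boldsymbol{x}$ is suppressed in the notation; $\mu(t)$ stands for $\mu(\boldsymbol{x},t)$. Let $V:=\{\mathbf{u}\in \mathrm{H}^1_0(\Omega)^d:\nabla\cdot\mathbf{u}=0\}$, a Hilbert space with inner product $(\mathbf{u},\mathbf{v})_V=\int_\Omega\underline{e}(\mathbf{u}):\underline{e}(\mathbf{v})\,\mathrm{d}\boldsymbol{x}$.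 The weak problem is: find $\mathbf{u}\in V$ with $\int_\Omega\mu(|\underline{e}(\mathbf{u})|^2)\underline{e}(\mathbf{u}):\underline{e}(\mathbf{v})\,\mathrm{d}\boldsymbol{x}=\int_\Omega\mathbf{f}\cdot\mathbf{v}\,\mathrm{d}\boldsymbol{x}$ for all $\mathbf{v}\in V$. The energy functional is $$\mathsf{E}(\mathbf{u}):=\int_\Omega\varphi(|\underline{e}(\mathbf{u})|^2)\,\mathrm{d}\boldsymbol{x}-\int_\Omega\mathbf{f}\cdot\mathbf{u}\,\mathrm{d}\boldsymbol{x},\qquad \varphi(s):=\frac12\int_0^s\mu(t)\,\mathrm{d}t.$$ Under (A1)--(A3) the weak problem has a unique solution $\mathbf{u}^\star\in V$, which is the unique minimiser of $\mathsf{E}$ in $V$. Kačanov iteration: given $\mathbf{u}^0\in V$, for $n=0,1,\ldots$ let $\mathbf{u}^{n+1}\in V$ be the (unique) element with $\int_\Omega\mu(|\underline{e}(\mathbf{u}^n)|^2)\underline{e}(\mathbf{u}^{n+1}):\underline{e}(\mathbf{v})\,\mathrm{d}\boldsymbol{x}=\int_\Omega\mathbf{f}\cdot\mathbf{v}\,\mathrm{d}\boldsymbol{x}$ for all $\mathbf{v}\in V$. *)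

theory Defs
  imports "HOL-Analysis.Analysis" "HOL-Probability.Essential_Supremum"
begin

section \<open>Bounded Lipschitz domains\<close>

text \<open>The boundary is locally the graph of a Lipschitz function of \<open>d - 1\<close> variables in a rotated
  coordinate system. The unit vector \<open>\<nu>\<close> is the vertical direction of that system, and the
  remaining \<open>d - 1\<close> coordinates of a point \<open>y\<close> are represented by its orthogonal projection
  \<open>y - (y \<bullet> \<nu>) \<nu>\<close> onto the hyperplane orthogonal to \<open>\<nu>\<close>.\<close>

definition bounded_lipschitz_domain :: "'a::euclidean_space set \<Rightarrow> bool" where
  "bounded_lipschitz_domain \<Omega> \<longleftrightarrow>
     open \<Omega> \<and> connected \<Omega> \<and> \<Omega> \<noteq> {} \<and> bounded \<Omega> \<and>
     (\<forall>p \<in> frontier \<Omega>. \<exists>r>0. \<exists>\<nu> \<gamma> L. norm \<nu> = 1 \<and> L-lipschitz_on {y. y \<bullet> \<nu> = 0} \<gamma> \<and>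
        \<Omega> \<inter> ball p r = {y \<in> ball p r. y \<bullet> \<nu> > (\<gamma> (y - (y \<bullet> \<nu>) *\<^sub>R \<nu>) :: real)})"


section \<open>Test functions\<close>

definition partial :: "'n \<Rightarrow> (real^'n \<Rightarrow> real) \<Rightarrow> real^'n::finite \<Rightarrow> real" where
  "partial i \<phi> x = frechet_derivative \<phi> (at x) (axis i 1)"

primrec Ck :: "nat \<Rightarrow> (real^'n::finite \<Rightarrow> real) \<Rightarrow> bool" where
  "Ck 0 \<phi> \<longleftrightarrow> continuous_on UNIV \<phi>"
| "Ck (Suc k) \<phi> \<longleftrightarrow> (\<forall>x. \<phi> differentiable (at x)) \<and> (\<forall>i. Ck k (partial i \<phi>))"

text \<open>\<open>C\<^sub>c\<^sup>\<infinity>(\<Omega>)\<close>, each function being extended by zero to the whole space.\<close>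

definition test_functions :: "(real^'n::finite) set \<Rightarrow> (real^'n \<Rightarrow> real) set" where
  "test_functions \<Omega> =
     {\<phi>. (\<forall>k. Ck k \<phi>) \<and> compact (closure {x. \<phi> x \<noteq> 0}) \<and> closure {x. \<phi> x \<noteq> 0} \<subseteq> \<Omega>}"


section \<open>Lebesgue and Sobolev spaces\<close>

text \<open>Elements of the spaces below are functions, not classes modulo equality almost everywhere.
  They are defined on the whole type, but only their values on \<open>\<Omega>\<close> matter.\<close>

definition L2 :: "'a::euclidean_space set \<Rightarrow> ('a \<Rightarrow> 'b::euclidean_space) set" where
  "L2 \<Omega> = {u. u \<in> borel_measurable (lebesgue_on \<Omega>) \<and>
               integrable (lebesgue_on \<Omega>) (\<lambda>x. (norm (u x))\<^sup>2)}"

definition has_weak_partial ::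
    "(real^'n::finite) set \<Rightarrow> 'n \<Rightarrow> (real^'n \<Rightarrow> real) \<Rightarrow> (real^'n \<Rightarrow> real) \<Rightarrow> bool" where
  "has_weak_partial \<Omega> i u g \<longleftrightarrow>
     (\<forall>\<phi> \<in> test_functions \<Omega>.
        (LINT x|lebesgue_on \<Omega>. u x * partial i \<phi> x) = - (LINT x|lebesgue_on \<Omega>. g x * \<phi> x))"

definition H1 :: "(real^'n::finite) set \<Rightarrow> (real^'n \<Rightarrow> real) set" where
  "H1 \<Omega> = {u \<in> L2 \<Omega>. \<forall>i. \<exists>g \<in> L2 \<Omega>. has_weak_partial \<Omega> i u g}"

text \<open>A representative of the weak partial derivative of a function in \<open>H\<^sup>1(\<Omega>)\<close>. It is determined
  only up to null sets, which does not affect any of the notions in which it is used.\<close>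

definition weak_partial ::
    "(real^'n::finite) set \<Rightarrow> 'n \<Rightarrow> (real^'n \<Rightarrow> real) \<Rightarrow> real^'n \<Rightarrow> real" where
  "weak_partial \<Omega> i u = (SOME g. g \<in> L2 \<Omega> \<and> has_weak_partial \<Omega> i u g)"

definition H1_norm :: "(real^'n::finite) set \<Rightarrow> (real^'n \<Rightarrow> real) \<Rightarrow> real" where
  "H1_norm \<Omega> u =
     sqrt ((LINT x|lebesgue_on \<Omega>. (u x)\<^sup>2) +
           (\<Sum>i\<in>UNIV. LINT x|lebesgue_on \<Omega>. (weak_partial \<Omega> i u x)\<^sup>2))"

text \<open>\<open>H\<^sub>0\<^sup>1(\<Omega>)\<close> is the closure of \<open>C\<^sub>c\<^sup>\<infinity>(\<Omega>)\<close> in \<open>H\<^sup>1(\<Omega>)\<close>.\<close>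

definition H10 :: "(real^'n::finite) set \<Rightarrow> (real^'n \<Rightarrow> real) set" where
  "H10 \<Omega> = {u \<in> H1 \<Omega>. \<forall>\<epsilon>>0. \<exists>\<phi> \<in> test_functions \<Omega>. H1_norm \<Omega> (\<lambda>x. u x - \<phi> x) < \<epsilon>}"

definition weak_div :: "(real^'n::finite) set \<Rightarrow> (real^'n \<Rightarrow> real^'n) \<Rightarrow> real^'n \<Rightarrow> real" where
  "weak_div \<Omega> u x = (\<Sum>i\<in>UNIV. weak_partial \<Omega> i (\<lambda>y. u y $ i) x)"

definition V_space :: "(real^'n::finite) set \<Rightarrow> (real^'n \<Rightarrow> real^'n) set" where
  "V_space \<Omega> = {u. (\<forall>i. (\<lambda>x. u x $ i) \<in> H10 \<Omega>) \<and> (AE x in lebesgue_on \<Omega>. weak_div \<Omega> u x = 0)}"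

text \<open>On \<^typ>\<open>real^'n^'n\<close> the library's \<^const>\<open>norm\<close> and \<^const>\<open>inner\<close> are the Frobenius norm and
  the Frobenius inner product.\<close>

definition sym_grad ::
    "(real^'n::finite) set \<Rightarrow> (real^'n \<Rightarrow> real^'n) \<Rightarrow> real^'n \<Rightarrow> real^'n^'n" where
  "sym_grad \<Omega> u x =
     (\<chi> i j. (weak_partial \<Omega> j (\<lambda>y. u y $ i) x + weak_partial \<Omega> i (\<lambda>y. u y $ j) x) / 2)"


section \<open>Viscosity, energy and the Kacanov iteration\<close>

text \<open>The derivative of a function on \<open>[0, \<infinity>)\<close>, one-sided at \<open>0\<close>.\<close>

definition deriv_nonneg :: "(real \<Rightarrow> real) \<Rightarrow> real \<Rightarrow> real" where
  "deriv_nonneg g t = vector_derivative g (at t within {0..})"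

definition visc_A1 :: "(real^'n::finite) set \<Rightarrow> (real^'n \<Rightarrow> real \<Rightarrow> real) \<Rightarrow> bool" where
  "visc_A1 \<Omega> \<mu> \<longleftrightarrow>
     continuous_on (closure \<Omega> \<times> {0..}) (\<lambda>(x, t). \<mu> x t) \<and>
     (\<forall>x \<in> closure \<Omega>. \<forall>t\<ge>0. \<mu> x differentiable (at t within {0..}))"

definition visc_A2 :: "(real^'n::finite) set \<Rightarrow> (real^'n \<Rightarrow> real \<Rightarrow> real) \<Rightarrow> bool" where
  "visc_A2 \<Omega> \<mu> \<longleftrightarrow>
     (\<exists>m>0. \<exists>M>0. \<forall>x \<in> closure \<Omega>. \<forall>s t. 0 \<le> s \<and> s \<le> t \<longrightarrow>
        m * (t - s) \<le> \<mu> x (t\<^sup>2) * t - \<mu> x (s\<^sup>2) * s \<and>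
        \<mu> x (t\<^sup>2) * t - \<mu> x (s\<^sup>2) * s \<le> M * (t - s))"

definition visc_A3 :: "(real^'n::finite) set \<Rightarrow> (real^'n \<Rightarrow> real \<Rightarrow> real) \<Rightarrow> bool" where
  "visc_A3 \<Omega> \<mu> \<longleftrightarrow> (\<forall>x \<in> closure \<Omega>. \<forall>t\<ge>0. deriv_nonneg (\<mu> x) t \<le> 0)"

definition \<phi>_pot :: "(real^'n::finite \<Rightarrow> real \<Rightarrow> real) \<Rightarrow> real^'n \<Rightarrow> real \<Rightarrow> real" where
  "\<phi>_pot \<mu> x s = 1/2 * integral {0..s} (\<mu> x)"

definition energy ::
    "(real^'n::finite) set \<Rightarrow> (real^'n \<Rightarrow> real \<Rightarrow> real) \<Rightarrow> (real^'n \<Rightarrow> real^'n) \<Rightarrow>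
     (real^'n \<Rightarrow> real^'n) \<Rightarrow> real" where
  "energy \<Omega> \<mu> f u =
     (LINT x|lebesgue_on \<Omega>. \<phi>_pot \<mu> x ((norm (sym_grad \<Omega> u x))\<^sup>2)) -
     (LINT x|lebesgue_on \<Omega>. f x \<bullet> u x)"

definition is_minimiser ::
    "(real^'n::finite) set \<Rightarrow> (real^'n \<Rightarrow> real \<Rightarrow> real) \<Rightarrow> (real^'n \<Rightarrow> real^'n) \<Rightarrow>
     (real^'n \<Rightarrow> real^'n) \<Rightarrow> bool" where
  "is_minimiser \<Omega> \<mu> f u \<longleftrightarrow>
     u \<in> V_space \<Omega> \<and> (\<forall>v \<in> V_space \<Omega>. energy \<Omega> \<mu> f u \<le> energy \<Omega> \<mu> f v)"

definition kacanov_iteration ::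
    "(real^'n::finite) set \<Rightarrow> (real^'n \<Rightarrow> real \<Rightarrow> real) \<Rightarrow> (real^'n \<Rightarrow> real^'n) \<Rightarrow>
     (nat \<Rightarrow> real^'n \<Rightarrow> real^'n) \<Rightarrow> bool" where
  "kacanov_iteration \<Omega> \<mu> f u \<longleftrightarrow>
     u 0 \<in> V_space \<Omega> \<and>
     (\<forall>n. u (Suc n) \<in> V_space \<Omega> \<and>
        (\<forall>v \<in> V_space \<Omega>.
           (LINT x|lebesgue_on \<Omega>. \<mu> x ((norm (sym_grad \<Omega> (u n) x))\<^sup>2) *
                                   (sym_grad \<Omega> (u (Suc n)) x \<bullet> sym_grad \<Omega> v x))
           = (LINT x|lebesgue_on \<Omega>. f x \<bullet> v x)))"

definition \<xi>_fun :: "(real^'n::finite \<Rightarrow> real \<Rightarrow> real) \<Rightarrow> real^'n \<Rightarrow> real \<Rightarrow> real" where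
  "\<xi>_fun \<mu> x t = \<mu> x (t\<^sup>2) * t"

text \<open>\<open>contraction_factor \<Omega> \<mu> w u\<close> is \<open>q(n)\<close> for \<open>w = u\<^sup>*\<close> and \<open>u = u\<^sup>n\<close>. The library's essential
  supremum is extended-real valued; under \<^const>\<open>visc_A2\<close> it is positive and at most \<open>M / m\<close> here. The
  library sets it to \<open>\<infinity>\<close> for non-measurable functions, but the quotient below is
  measurable under \<^const>\<open>visc_A1\<close> and \<^const>\<open>visc_A2\<close>: on a nondegenerate interval the infimum of
  \<open>\<xi>'\<close> equals the infimum of the difference quotients of \<open>\<xi>\<close>.\<close>

definition contraction_factor ::
    "(real^'n::finite) set \<Rightarrow> (real^'n \<Rightarrow> real \<Rightarrow> real) \<Rightarrow> (real^'n \<Rightarrow> real^'n) \<Rightarrow>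
     (real^'n \<Rightarrow> real^'n) \<Rightarrow> real" where
  "contraction_factor \<Omega> \<mu> w u =
     1 - 1/4 * inverse (real_of_ereal (esssup (lebesgue_on \<Omega>) (\<lambda>x. ereal (
       \<mu> x ((norm (sym_grad \<Omega> u x))\<^sup>2) /
       (INF t\<in>{-1<..<1}. deriv_nonneg (\<xi>_fun \<mu> x)
          (max 0 (norm (sym_grad \<Omega> w x) + t * norm (sym_grad \<Omega> u x - sym_grad \<Omega> w x))))))))"

end

theory Submission
  imports Defs
begin

text \<open>Write \<open>e\<^sub>0, e\<^sub>1, e\<^sub>*\<close> for the strains of \<open>u\<^sup>n, u\<^sup>n\<^sup>+\<^sup>1, u\<^sup>*\<close>, let \<open>a = \<mu>(|e\<^sub>0|\<^sup>2)\<close>, let \<open>k\<close> be the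
  infimum of \<open>\<xi>'\<close> in the statement and let \<open>\<lambda>\<close> be the inverse of the essential supremum, so
  \<open>\<lambda> a \<le> k\<close> almost everywhere. Concavity of \<open>\<phi>\<close> bounds \<open>\<phi>(|e\<^sub>1|\<^sup>2) - \<phi>(|e\<^sub>0|\<^sup>2)\<close> from above by
  \<open>a (|e\<^sub>1|\<^sup>2 - |e\<^sub>0|\<^sup>2) / 2\<close>, and \<open>k\<close>-convexity of \<open>A \<mapsto> \<phi>(|A|\<^sup>2)\<close> near \<open>e\<^sub>*\<close> bounds
  \<open>\<phi>(|e\<^sub>0|\<^sup>2) - \<phi>(|e\<^sub>*|\<^sup>2)\<close> from above by \<open>a e\<^sub>0 : (e\<^sub>0 - e\<^sub>*) - k |e\<^sub>0 - e\<^sub>*|\<^sup>2 / 2\<close>. Adding \<open>\<lambda>\<close> times the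
  second bound to the first bounds the left-hand sides by
  \<open>a e\<^sub>1 : (e\<^sub>1 - e\<^sub>0) + \<lambda> a e\<^sub>1 : (e\<^sub>0 - e\<^sub>*)\<close> minus a weighted square. After integration the iteration
  equation, tested only with \<open>u\<^sup>n\<close>, \<open>u\<^sup>n\<^sup>+\<^sup>1\<close> and \<open>u\<^sup>*\<close>, yields
  \<open>E(u\<^sup>n\<^sup>+\<^sup>1) - E(u\<^sup>n) + \<lambda> (E(u\<^sup>n) - E(u\<^sup>*)) \<le> 0\<close>, which is the claim even with \<open>1 - \<lambda>\<close>
  in place of \<open>1 - \<lambda> / 4\<close>.\<close>

section \<open>One-sided derivatives on the half-line\<close>

lemma deriv_nonneg_DERIV:
  assumes "g differentiable (at t within {0..})" "t \<ge> 0"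
  shows "(g has_real_derivative deriv_nonneg g t) (at t within {0..})"
  using assms by (simp add: deriv_nonneg_def has_real_derivative_iff_has_vector_derivative
      vector_derivative_works)

lemma at_within_Ici_neq_bot:
  fixes t :: real
  assumes "t \<ge> 0"
  shows "at t within {0..} \<noteq> bot"
proof -
  have "t islimpt {0..}"
  proof (rule islimpt_subset)
    show "t islimpt {t..t+1}" by (rule islimpt_Icc[THEN iffD2]) auto
  qed (use assms in auto)
  then show ?thesis by (simp add: trivial_limit_within)
qed

lemma deriv_nonneg_unique:
  assumes "(g has_real_derivative D) (at t within {0..})" "t \<ge> 0"
  shows "deriv_nonneg g t = D"
proof -
  have "at t within {0..} \<noteq> bot" using assms(2) by (rule at_within_Ici_neq_bot)
  with assms show ?thesis unfolding deriv_nonneg_def has_real_derivative_iff_has_vector_derivative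
    by (intro vector_derivative_within)
qed

text \<open>Lets the intervals below start at \<open>0\<close>, where \<open>DERIV_pot\<close> gives
  no derivative.\<close>

lemma MVT_open:
  fixes f f' :: "real \<Rightarrow> real"
  assumes "a < b" "continuous_on {a..b} f"
    and f': "\<And>x. a < x \<Longrightarrow> x < b \<Longrightarrow> (f has_real_derivative f' x) (at x)"
  obtains z where "a < z" "z < b" "f b - f a = (b - a) * f' z"
proof -
  have "f differentiable (at x)" if "a < x" "x < b" for x
    using f'[OF that] by (auto simp: real_differentiable_def)
  from MVT[OF assms(1,2) this] obtain l z where
    "a < z" "z < b" "(f has_real_derivative l) (at z)" "f b - f a = (b - a) * l" by blast
  then show ?thesis using DERIV_unique[OF _ f'[of z], of l] that by blast
qed

section \<open>Pointwise estimates for the viscosity at one fixed point of the domain\<close>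

locale viscosity_profile =
  fixes g :: "real \<Rightarrow> real" and m :: real
  assumes diff: "\<And>t. t \<ge> 0 \<Longrightarrow> g differentiable (at t within {0..})"
    and dec: "\<And>t. t \<ge> 0 \<Longrightarrow> deriv_nonneg g t \<le> 0"
    and strong_mono: "\<And>s t. 0 \<le> s \<Longrightarrow> s \<le> t \<Longrightarrow> m * (t - s) \<le> g (t\<^sup>2) * t - g (s\<^sup>2) * s"
begin

abbreviation "\<xi> \<equiv> (\<lambda>t. g (t\<^sup>2) * t)"
abbreviation "pot \<equiv> (\<lambda>s. 1/2 * integral {0..s} g)"

lemma cont: "continuous_on {0..} g"
  using diff by (auto simp: continuous_on_eq_continuous_within intro!: differentiable_imp_continuous_within)

lemma DERIV_profile:
  assumes "t > 0"
  shows "(g has_real_derivative deriv_nonneg g t) (at t)"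
proof -
  have "at t within {0..} = at t"
    using assms by (intro at_within_interior) (simp add: interior_Ici[of "-1"])
  then show ?thesis using deriv_nonneg_DERIV[OF diff, of t] assms by simp
qed

lemma antimono:
  assumes "0 \<le> s" "s \<le> t"
  shows "g t \<le> g s"
proof (cases "s = t")
  case False
  show ?thesis
  proof (rule DERIV_nonpos_imp_decreasing_open[of s t g])
    show "\<exists>y. (g has_real_derivative y) (at x) \<and> y \<le> 0" if "s < x" "x < t" for x
      using DERIV_profile[of x] dec[of x] that assms by auto
    show "continuous_on {s..t} g" by (rule continuous_on_subset[OF cont]) (use assms in auto)
  qed (use assms False in auto)
qed simp

lemma DERIV_pot:
  assumes "t > 0"
  shows "(pot has_real_derivative g t / 2) (at t)"
proof -
  have "((\<lambda>x. integral {0..x} g) has_real_derivative g t) (at t within {0..t+1})"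
    by (rule integral_has_real_derivative[OF continuous_on_subset[OF cont]]) (use assms in auto)
  moreover have "at t within {0..t+1} = at t"
    using assms by (intro at_within_interior) simp
  ultimately have "((\<lambda>x. integral {0..x} g) has_real_derivative g t) (at t)" by simp
  from DERIV_cmult[OF this, of "1/2"] show ?thesis by simp
qed

lemma cont_pot: "continuous_on {0..b} pot"
  by (intro continuous_intros indefinite_integral_continuous_1 integrable_continuous_interval
      continuous_on_subset[OF cont]) auto

text \<open>The derivative \<open>g / 2\<close> of the potential is decreasing, so tangents lie
  above the graph; the mean value theorem is applied on either side of \<open>t\<close>.\<close>

lemma pot_concave:
  assumes "0 \<le> s" "0 \<le> t"
  shows "pot s - pot t \<le> g t / 2 * (s - t)"
proof (cases s t rule: linorder_cases)
  case less
  obtain z where z: "s < z" "z < t" "pot t - pot s = (t - s) * (g z / 2)"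
    using MVT_open[OF less continuous_on_subset[OF cont_pot[of t]] DERIV_pot] assms by auto
  have "(t - s) * (g t / 2) \<le> (t - s) * (g z / 2)"
    using antimono[of z t] z assms by (intro mult_left_mono) auto
  moreover have "g t / 2 * (s - t) = - ((t - s) * (g t / 2))" by (simp add: field_simps)
  ultimately show ?thesis using z(3) by linarith
next
  case greater
  obtain z where z: "t < z" "z < s" "pot s - pot t = (s - t) * (g z / 2)"
    using MVT_open[OF greater continuous_on_subset[OF cont_pot[of s]] DERIV_pot] assms by auto
  have "(s - t) * (g z / 2) \<le> (s - t) * (g t / 2)"
    using antimono[of t z] z assms by (intro mult_left_mono) auto
  then show ?thesis using z(3) by (simp add: mult.commute)
qed simp

text \<open>Squaring maps the half-line into itself, so the chain rule holds for one-sided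
  derivatives, also at \<open>0\<close>.\<close>

lemma DERIV_flux:
  assumes "t \<ge> 0"
  shows "(\<xi> has_real_derivative (deriv_nonneg g (t\<^sup>2) * (2 * t)) * t + g (t\<^sup>2)) (at t within {0..})"
proof -
  have "(g has_real_derivative deriv_nonneg g (t\<^sup>2)) (at (t\<^sup>2) within power2 ` {0..})"
    by (rule DERIV_subset[OF deriv_nonneg_DERIV[OF diff]]) auto
  moreover have "(power2 has_real_derivative 2 * t) (at t within {0..})"
    by (auto intro!: derivative_eq_intros)
  ultimately have "((\<lambda>t. g (t\<^sup>2)) has_real_derivative deriv_nonneg g (t\<^sup>2) * (2 * t)) (at t within {0..})"
    by (rule DERIV_image_chain[unfolded o_def])
  then show ?thesis by (auto intro!: derivative_eq_intros)
qed

lemma deriv_flux: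
  assumes "t \<ge> 0"
  shows "(\<xi> has_real_derivative deriv_nonneg \<xi> t) (at t within {0..})"
  using DERIV_flux[OF assms] deriv_nonneg_unique[OF DERIV_flux[OF assms]] assms by simp

text \<open>By the chain rule \<open>\<xi>'(t) = g(t^2) + 2 t^2 g'(t^2)\<close>, and (A3) makes the
  second term nonpositive.\<close>

lemma deriv_flux_le:
  assumes "t \<ge> 0"
  shows "deriv_nonneg \<xi> t \<le> g (t\<^sup>2)"
proof -
  have "deriv_nonneg g (t\<^sup>2) * (2 * t) * t \<le> 0"
    using dec[of "t\<^sup>2"] assms by (simp add: mult_nonpos_nonneg)
  then show ?thesis
    using deriv_nonneg_unique[OF DERIV_flux[OF assms]] assms by simp
qed

text \<open>By \<open>strong_mono\<close> the difference quotients of \<open>\<xi>\<close> on both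
  sides of \<open>t\<close> are at least \<open>m\<close>, and the bound survives the limit.\<close>

lemma deriv_flux_ge:
  assumes "t \<ge> 0"
  shows "m \<le> deriv_nonneg \<xi> t"
proof -
  have lim: "((\<lambda>y. (\<xi> y - \<xi> t) / (y - t)) \<longlongrightarrow> deriv_nonneg \<xi> t) (at t within {0..})"
    using deriv_flux[OF assms] by (simp add: has_field_derivative_iff)
  have "m \<le> (\<xi> y - \<xi> t) / (y - t)" if "y \<ge> 0" "y \<noteq> t" for y
  proof (cases "y > t")
    case True
    then show ?thesis using strong_mono[of t y] assms by (simp add: field_simps)
  next
    case False
    then have "y < t" using that by simp
    then show ?thesis using strong_mono[of y t] that by (simp add: field_simps)
  qed
  then have "\<forall>\<^sub>F y in at t within {0..}. m \<le> (\<xi> y - \<xi> t) / (y - t)"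
    by (auto simp: eventually_at intro!: exI[of _ 1])
  then show ?thesis by (rule tendsto_lowerbound[OF lim _ at_within_Ici_neq_bot[OF assms]])
qed

lemma viscosity_ge:
  assumes "t \<ge> 0"
  shows "m \<le> g t"
  using deriv_flux_ge[of "sqrt t"] deriv_flux_le[of "sqrt t"] assms by simp

text \<open>Radial reduction: subtracting \<open>k |\<cdot>|\<^sup>2 / 2\<close> leaves a function of the norm alone, whose radial
  derivative \<open>\<xi>(r) - k r\<close> is monotone between \<open>|B|\<close> and \<open>|A|\<close>; the angular part is handled by
  Cauchy--Schwarz, since \<open>k \<le> g (|A|\<^sup>2)\<close>.\<close>

lemma pot_strongly_convex:
  fixes A B :: "'b::real_inner"
  assumes k: "\<And>t. t \<in> {-1<..<1} \<Longrightarrow> k \<le> deriv_nonneg \<xi> (max 0 (norm B + t * norm (A - B)))"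
  shows "pot ((norm A)\<^sup>2) + g ((norm A)\<^sup>2) * (A \<bullet> (B - A)) + k/2 * (norm (B - A))\<^sup>2 \<le> pot ((norm B)\<^sup>2)"
proof (cases "A = B")
  case False
  define a b d where "a = norm A" and "b = norm B" and "d = norm (A - B)"
  have d: "d > 0" "\<bar>a - b\<bar> \<le> d" and ab: "a \<ge> 0" "b \<ge> 0"
    using False norm_triangle_ineq3[of A B] by (auto simp: a_def b_def d_def)
  \<comment> \<open>Since \<open>\<bar>a - b\<bar> \<le> d\<close>, the parameter
    \<open>t * (a - b) / d\<close> lies in (-1,1). The radius is a convex combination of two norms,
    so the \<open>max\<close> with \<open>0\<close> does not change it.\<close>
  have kc: "k \<le> deriv_nonneg \<xi> (b + t * (a - b))" if "0 \<le> t" "t < 1" for t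
  proof -
    have "\<bar>t * (a - b)\<bar> \<le> t * d"
      using that d by (simp add: abs_mult mult_left_mono)
    also have "\<dots> < d" using that d by simp
    finally have "-1 < t * (a - b) / d" "t * (a - b) / d < 1"
      using d by (auto simp: field_simps abs_less_iff)
    moreover have "b + t * (a - b) = (1 - t) * b + t * a" by (simp add: algebra_simps)
    then have "0 \<le> b + t * (a - b)" using that ab by simp
    ultimately show ?thesis using k[of "t * (a - b) / d"] d
      by (simp add: a_def[symmetric] b_def[symmetric] d_def[symmetric] max_def)
  qed
  have ks: "k \<le> deriv_nonneg \<xi> s" if "min a b < s" "s < max a b" for s
  proof -
    have "a \<noteq> b" using that by auto
    then have "b + (s - b) / (a - b) * (a - b) = s" by simp
    moreover have "0 \<le> (s - b) / (a - b)" "(s - b) / (a - b) < 1"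
      using that by (cases "a < b"; auto simp: divide_simps)+
    ultimately show ?thesis using kc[of "(s - b) / (a - b)"] by simp
  qed
  \<comment> \<open>The hypothesis may miss the radius \<open>a\<close> when
    \<open>\<bar>a - b\<bar> = d\<close>, and \<open>\<xi>'\<close> need not be continuous. So
    \<open>k \<le> \<xi>' \<le> g\<close> is used for \<open>t < 1\<close>, and continuity of
    \<open>g\<close> carries the bound to \<open>t = 1\<close>.\<close>
  have ka: "k \<le> g (a\<^sup>2)"
  proof -
    have "((\<lambda>t. g ((b + t * (a - b))\<^sup>2)) \<longlongrightarrow> g ((b + 1 * (a - b))\<^sup>2)) (at 1 within {0..1})"
    proof -
      have "continuous_on {0..1} (\<lambda>t. g ((b + t * (a - b))\<^sup>2))"
        by (intro continuous_on_compose2[OF cont] continuous_intros) auto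
      from this[unfolded continuous_on_def, rule_format, of 1] show ?thesis by simp
    qed
    moreover have "at 1 within {0..1::real} \<noteq> bot" by (simp add: at_within_Icc_at_left)
    moreover have "k \<le> g ((b + t * (a - b))\<^sup>2)" if "0 \<le> t" "t < 1" for t
    proof -
      have "b + t * (a - b) = (1 - t) * b + t * a" by (simp add: algebra_simps)
      then have "0 \<le> b + t * (a - b)" using that ab by simp
      then show ?thesis using kc[OF that] deriv_flux_le by fastforce
    qed
    then have "\<forall>\<^sub>F t in at 1 within {0..1}. k \<le> g ((b + t * (a - b))\<^sup>2)"
      by (auto simp: eventually_at intro!: exI[of _ 1])
    ultimately have "k \<le> g ((b + 1 * (a - b))\<^sup>2)"
      by (intro tendsto_lowerbound)
    then show ?thesis by simp
  qed
  have mono: "\<xi> s - k * s \<le> \<xi> t - k * t" if "min a b \<le> s" "s \<le> t" "t \<le> max a b" for s t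
  proof -
    have "(\<lambda>r. \<xi> r - k * r) s \<le> (\<lambda>r. \<xi> r - k * r) t"
    proof (rule DERIV_nonneg_imp_increasing_open[of s t "\<lambda>r. \<xi> r - k * r"])
      show "s \<le> t" using that by simp
      show "\<exists>y. ((\<lambda>r. \<xi> r - k * r) has_real_derivative y) (at x) \<and> 0 \<le> y" if x: "s < x" "x < t" for x
      proof -
        have x0: "x > 0" using x \<open>min a b \<le> s\<close> ab by auto
        have "at x within {0..} = at x"
          using x0 by (intro at_within_interior) (simp add: interior_Ici[of "-1"])
        then have "(\<xi> has_real_derivative deriv_nonneg \<xi> x) (at x)"
          using deriv_flux[of x] x0 by simp
        then have "((\<lambda>r. \<xi> r - k * r) has_real_derivative deriv_nonneg \<xi> x - k) (at x)"
          by (rule DERIV_diff) (auto intro!: derivative_eq_intros)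
        moreover have "k \<le> deriv_nonneg \<xi> x"
          by (rule ks) (use x \<open>min a b \<le> s\<close> \<open>t \<le> max a b\<close> in auto)
        ultimately show ?thesis by (intro exI[of _ "deriv_nonneg \<xi> x - k"]) auto
      qed
      show "continuous_on {s..t} (\<lambda>r. \<xi> r - k * r)"
        by (intro continuous_intros continuous_on_compose2[OF cont]) auto
    qed
    then show ?thesis .
  qed
  \<comment> \<open>The radial profile of the potential minus the quadratic; its derivative
    \<open>\<xi> r - k * r\<close> increases between \<open>a\<close> and \<open>b\<close> by
    \<open>mono\<close>.\<close>
  define P where "P r = pot (r\<^sup>2) - k/2 * r\<^sup>2" for r
  have P': "(P has_real_derivative \<xi> r - k * r) (at r)" if "r > 0" for r
  proof -
    have "((\<lambda>r. pot (r\<^sup>2)) has_real_derivative g (r\<^sup>2) / 2 * (2 * r)) (at r)"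
      by (rule DERIV_chain2[OF DERIV_pot]) (use that in \<open>auto intro!: derivative_eq_intros\<close>)
    moreover have "((\<lambda>r. k/2 * r\<^sup>2) has_real_derivative k * r) (at r)"
      by (auto intro!: derivative_eq_intros)
    ultimately show ?thesis
      unfolding P_def using DERIV_diff by fastforce
  qed
  have contP: "continuous_on {c..e} P" if "0 \<le> c" for c e
    unfolding P_def
    by (intro continuous_intros continuous_on_compose2[OF cont_pot[of "e\<^sup>2"]])
       (use that in \<open>auto intro!: power_mono\<close>)
  have convex: "(\<xi> a - k * a) * (b - a) \<le> P b - P a"
  proof (cases a b rule: linorder_cases)
    case less
    obtain z where z: "a < z" "z < b" "P b - P a = (b - a) * (\<xi> z - k * z)"
      using MVT_open[OF less contP P'] ab by auto
    then show ?thesis using mono[of a z] less by (simp add: mult.commute mult_left_mono)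
  next
    case greater
    obtain z where z: "b < z" "z < a" "P a - P b = (a - b) * (\<xi> z - k * z)"
      using MVT_open[OF greater contP P'] ab by auto
    have "(a - b) * (\<xi> z - k * z) \<le> (a - b) * (\<xi> a - k * a)"
      using mono[of z a] z by (intro mult_left_mono) auto
    then show ?thesis using z by (simp add: algebra_simps)
  qed simp
  have CS: "(g (a\<^sup>2) - k) * (A \<bullet> (B - A)) \<le> (g (a\<^sup>2) - k) * (a * b - a\<^sup>2)"
    using ka norm_cauchy_schwarz[of A B]
    by (intro mult_left_mono) (auto simp: a_def b_def inner_diff_right power2_norm_eq_inner)
  have nBA: "(norm (B - A))\<^sup>2 = b\<^sup>2 - a\<^sup>2 - 2 * (A \<bullet> (B - A))"
    unfolding a_def b_def power2_norm_eq_inner by (simp add: inner_diff inner_commute algebra_simps)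
  \<comment> \<open>The bound in \<open>CS\<close> is exactly the tangent term of
    \<open>convex\<close>, so the angular and radial estimates chain.\<close>
  have "(g (a\<^sup>2) - k) * (a * b - a\<^sup>2) = (\<xi> a - k * a) * (b - a)"
    by (simp add: algebra_simps power2_eq_square)
  with convex CS have "(g (a\<^sup>2) - k) * (A \<bullet> (B - A)) \<le> P b - P a" by simp
  then show ?thesis
    unfolding a_def[symmetric] b_def[symmetric] nBA P_def by (simp add: field_simps)
qed simp

text \<open>The right-hand side contains only products of \<open>a\<close> and \<open>e1\<close>
  with another strain, so that after integration each term is an instance of the iteration
  equation.\<close>

lemma kacanov_pointwise:
  fixes e0 e1 es :: "'b::real_inner"
  defines "a \<equiv> g ((norm e0)\<^sup>2)"
  assumes m: "m > 0" and l: "0 \<le> l"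
    and k: "l * a \<le> (INF t\<in>{-1<..<1}. deriv_nonneg \<xi> (max 0 (norm es + t * norm (e0 - es))))"
  shows "pot ((norm e1)\<^sup>2) - pot ((norm e0)\<^sup>2) + l * (pot ((norm e0)\<^sup>2) - pot ((norm es)\<^sup>2))
    \<le> a * (e1 \<bullet> e1) - a * (e1 \<bullet> e0) + l * (a * (e1 \<bullet> e0) - a * (e1 \<bullet> es))"
proof -
  \<comment> \<open>Strong convexity is used with the constant \<open>l * a\<close>. The lower bound
    \<open>m\<close> makes the real-valued \<open>INF\<close> a true lower bound of the
    family.\<close>
  have "l * a \<le> deriv_nonneg \<xi> (max 0 (norm es + t * norm (e0 - es)))" if "t \<in> {-1<..<1}" for t
    by (rule order_trans[OF k], rule cINF_lower[OF _ that])
       (auto intro!: bdd_belowI[of _ m] deriv_flux_ge)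
  from pot_strongly_convex[OF this]
  have 2: "l * (pot ((norm e0)\<^sup>2) - pot ((norm es)\<^sup>2)) \<le>
      l * (- a * (e0 \<bullet> (es - e0)) - l * a / 2 * (norm (es - e0))\<^sup>2)"
    unfolding a_def by (intro mult_left_mono l) (simp add: algebra_simps)
  have 1: "pot ((norm e1)\<^sup>2) - pot ((norm e0)\<^sup>2) \<le> a / 2 * ((norm e1)\<^sup>2 - (norm e0)\<^sup>2)"
    unfolding a_def by (rule pot_concave) auto
  have "a \<ge> 0" using viscosity_ge[of "(norm e0)\<^sup>2"] m by (simp add: a_def)
  then have 3: "0 \<le> a / 2 * (norm (e1 - e0 - l *\<^sub>R (es - e0)))\<^sup>2" by simp
  \<comment> \<open>Completing the square: the convexity gain multiplied by \<open>l\<close>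
    supplies its \<open>l^2\<close> term.\<close>
  have "a / 2 * ((norm e1)\<^sup>2 - (norm e0)\<^sup>2) + l * (- a * (e0 \<bullet> (es - e0)) - l * a / 2 * (norm (es - e0))\<^sup>2)
      = a * (e1 \<bullet> e1) - a * (e1 \<bullet> e0) + l * (a * (e1 \<bullet> e0) - a * (e1 \<bullet> es))
        - a / 2 * (norm (e1 - e0 - l *\<^sub>R (es - e0)))\<^sup>2"
    unfolding power2_norm_eq_inner
    by (simp add: inner_diff inner_commute algebra_simps power2_eq_square field_simps)
  with 1 2 3 show ?thesis by linarith
qed

text \<open>Provides the integrable majorant of the potential; the upper bound comes from the
  tangent at \<open>0\<close>.\<close>

lemma pot_bounds:
  assumes "m \<ge> 0" and M: "\<And>t. t \<ge> 0 \<Longrightarrow> g t \<le> M" and "s \<ge> 0"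
  shows "0 \<le> pot s \<and> pot s \<le> M * s"
proof
  have "pot s \<le> g 0 / 2 * s" using pot_concave[of s 0] assms by simp
  also have "g 0 / 2 * s \<le> M * s"
    using M[of 0] viscosity_ge[of 0] assms by (intro mult_right_mono) linarith+
  finally show "pot s \<le> M * s" .
  show "0 \<le> pot s"
    using integral_nonneg[OF integrable_continuous_interval[OF continuous_on_subset[OF cont]], of 0 s]
      viscosity_ge assms by (auto intro: order_trans)
qed

end

section \<open>Square-integrability of the strains\<close>

lemma L2_mult_inner_integrable:
  fixes e h :: "'a::euclidean_space \<Rightarrow> 'b::euclidean_space"
  assumes e: "e \<in> L2 \<Omega>" and h: "h \<in> L2 \<Omega>"
    and a: "a \<in> borel_measurable (lebesgue_on \<Omega>)" "\<And>x. x \<in> \<Omega> \<Longrightarrow> \<bar>a x\<bar> \<le> M"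
  shows "integrable (lebesgue_on \<Omega>) (\<lambda>x. a x * (e x \<bullet> h x))"
proof (rule Bochner_Integration.integrable_bound)
  show "integrable (lebesgue_on \<Omega>) (\<lambda>x. M * ((norm (e x))\<^sup>2 + (norm (h x))\<^sup>2))"
    using e h by (auto simp: L2_def)
  show "(\<lambda>x. a x * (e x \<bullet> h x)) \<in> borel_measurable (lebesgue_on \<Omega>)"
    using e h a by (auto simp: L2_def)
  have "norm (a x * (e x \<bullet> h x)) \<le> norm (M * ((norm (e x))\<^sup>2 + (norm (h x))\<^sup>2))" if "x \<in> \<Omega>" for x
  proof -
    have "\<bar>e x \<bullet> h x\<bar> \<le> norm (e x) * norm (h x)" by (rule Cauchy_Schwarz_ineq2)
    also have "\<dots> \<le> (norm (e x))\<^sup>2 + (norm (h x))\<^sup>2"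
      using sum_squares_bound[of "norm (e x)" "norm (h x)"]
        mult_nonneg_nonneg[OF norm_ge_zero norm_ge_zero, of "e x" "h x"] by linarith
    finally have "\<bar>a x\<bar> * \<bar>e x \<bullet> h x\<bar> \<le> M * ((norm (e x))\<^sup>2 + (norm (h x))\<^sup>2)"
      using a(2)[OF that] by (intro mult_mono) auto
    then have "\<bar>a x * (e x \<bullet> h x)\<bar> \<le> \<bar>M * ((norm (e x))\<^sup>2 + (norm (h x))\<^sup>2)\<bar>"
      unfolding abs_mult[of "a x"] by linarith
    then show ?thesis by simp
  qed
  then show "AE x in lebesgue_on \<Omega>. norm (a x * (e x \<bullet> h x)) \<le> norm (M * ((norm (e x))\<^sup>2 + (norm (h x))\<^sup>2))"
    by (intro AE_I2) simp
qed

lemma L2_vec_lambda: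
  fixes e :: "'i::finite \<Rightarrow> 'a::euclidean_space \<Rightarrow> 'b::euclidean_space"
  assumes e: "\<And>i. e i \<in> L2 \<Omega>"
  shows "(\<lambda>x. \<chi> i. e i x) \<in> L2 \<Omega>"
proof -
  have "(\<lambda>x. (\<chi> i. e i x) \<bullet> b) \<in> borel_measurable (lebesgue_on \<Omega>)" for b
    using e unfolding inner_vec_def L2_def
    by (auto intro!: borel_measurable_sum borel_measurable_inner)
  then have "(\<lambda>x. \<chi> i. e i x) \<in> borel_measurable (lebesgue_on \<Omega>)"
    by (subst borel_measurable_euclidean_space) auto
  moreover have "(norm (\<chi> i. e i x))\<^sup>2 = (\<Sum>i\<in>UNIV. (norm (e i x))\<^sup>2)" for x
    by (simp add: power2_norm_eq_inner inner_vec_def)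
  ultimately show ?thesis using e by (auto simp: L2_def)
qed

lemma weak_partial_L2:
  assumes "u \<in> H1 \<Omega>"
  shows "weak_partial \<Omega> i u \<in> L2 \<Omega>"
proof -
  have "\<exists>g. g \<in> L2 \<Omega> \<and> has_weak_partial \<Omega> i u g" using assms by (auto simp: H1_def)
  then show ?thesis unfolding weak_partial_def by (rule someI2_ex) simp
qed

lemma sym_grad_L2:
  fixes u :: "real^'n::finite \<Rightarrow> real^'n"
  assumes "u \<in> V_space \<Omega>"
  shows "sym_grad \<Omega> u \<in> L2 \<Omega>"
proof -
  have wp: "weak_partial \<Omega> j (\<lambda>y. u y $ i) \<in> L2 \<Omega>" for i j
    using assms by (intro weak_partial_L2) (auto simp: V_space_def H10_def)
  have half: "(\<lambda>x. (p x + q x) / 2) \<in> L2 \<Omega>" if p: "p \<in> L2 \<Omega>" and q: "q \<in> L2 \<Omega>"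
    for p q :: "real^'n \<Rightarrow> real"
  proof -
    have "integrable (lebesgue_on \<Omega>) (\<lambda>x. 1/4 * (norm (p x))\<^sup>2 + 1/4 * (norm (q x))\<^sup>2 + 1/2 * (p x \<bullet> q x))"
      using p q by (intro Bochner_Integration.integrable_add integrable_mult_right
          L2_mult_inner_integrable[where M = "1/2"]) (auto simp: L2_def)
    moreover have "1/4 * (norm (p x))\<^sup>2 + 1/4 * (norm (q x))\<^sup>2 + 1/2 * (p x \<bullet> q x)
        = (norm ((p x + q x) / 2))\<^sup>2" for x
      unfolding real_norm_def power2_abs by (simp add: power2_eq_square field_simps)
    ultimately have "integrable (lebesgue_on \<Omega>) (\<lambda>x. (norm ((p x + q x) / 2))\<^sup>2)"
      by simp
    then show ?thesis using p q unfolding L2_def by (auto simp del: real_norm_def)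
  qed
  show ?thesis
    unfolding sym_grad_def[abs_def] by (intro L2_vec_lambda half wp)
qed

section \<open>Measurability of the viscosity and the potential along a strain\<close>

lemma borel_measurable_continuous_on_comp:
  assumes "continuous_on S F" "h \<in> borel_measurable M" "h ` space M \<subseteq> S"
  shows "(\<lambda>x. F (h x)) \<in> borel_measurable M"
  using measurable_comp[OF measurable_restrict_space2 borel_measurable_continuous_on_restrict[OF assms(1)], of h M]
    assms by (auto simp: o_def)

text \<open>Moving \<open>s\<close> from the endpoint into the integrand leaves a fixed interval, so
  joint continuity follows from that of parameter integrals.\<close>

lemma \<phi>_pot_rescale:
  assumes "s \<ge> 0"
  shows "\<phi>_pot \<mu> x s = s / 2 * integral {0..1} (\<lambda>r. \<mu> x (s * r))"
proof (cases "s = 0")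
  case False
  have "(\<lambda>r. r / s) ` {0..s} = {0..1}"
    using False assms by (auto simp: image_divide_atLeastAtMost)
  then show ?thesis
    using integral_stretch_real[of s 0 s "\<mu> x"] False assms by (simp add: \<phi>_pot_def)
qed (simp add: \<phi>_pot_def)

lemma continuous_on_\<phi>_pot:
  assumes "visc_A1 \<Omega> \<mu>"
  shows "continuous_on (closure \<Omega> \<times> {0..}) (\<lambda>(x, s). \<phi>_pot \<mu> x s)"
proof -
  have c: "continuous_on (closure \<Omega> \<times> {0..}) (\<lambda>(x, t). \<mu> x t)"
    using assms by (simp add: visc_A1_def)
  have "continuous_on ((closure \<Omega> \<times> {0..}) \<times> cbox 0 1) (\<lambda>(p, r). \<mu> (fst p) (snd p * r))"
    using continuous_on_compose2[OF c, of "(closure \<Omega> \<times> {0..}) \<times> cbox 0 1" "\<lambda>(p, r). (fst p, snd p * r)"]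
    by (fastforce simp: case_prod_unfold intro!: continuous_intros)
  from integral_continuous_on_param[OF this]
  have "continuous_on (closure \<Omega> \<times> {0..})
          (\<lambda>p. snd p / 2 * integral {0..1} (\<lambda>r. \<mu> (fst p) (snd p * r)))"
    unfolding cbox_interval by (intro continuous_intros) auto
  then show ?thesis
    by (rule continuous_on_eq) (auto simp: \<phi>_pot_rescale)
qed

section \<open>Integration over the domain and the contraction estimate\<close>

theorem theorem3p2:
  fixes \<Omega> :: "(real^'n::finite) set"
    and f :: "real^'n \<Rightarrow> real^'n"
    and \<mu> :: "real^'n \<Rightarrow> real \<Rightarrow> real"
    and ustar :: "real^'n \<Rightarrow> real^'n"
    and u :: "nat \<Rightarrow> real^'n \<Rightarrow> real^'n"
  assumes dim: "CARD('n) \<in> {2, 3}"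
    and domain: "bounded_lipschitz_domain \<Omega>"
    and f: "f \<in> L2 \<Omega>"
    and A1: "visc_A1 \<Omega> \<mu>"
    and A2: "visc_A2 \<Omega> \<mu>"
    and A3: "visc_A3 \<Omega> \<mu>"
    and ustar: "is_minimiser \<Omega> \<mu> f ustar"
    and u: "kacanov_iteration \<Omega> \<mu> f u"
  shows "\<forall>n. 0 \<le> energy \<Omega> \<mu> f (u (Suc n)) - energy \<Omega> \<mu> f ustar \<and>
             energy \<Omega> \<mu> f (u (Suc n)) - energy \<Omega> \<mu> f ustar
               \<le> contraction_factor \<Omega> \<mu> ustar (u n) * (energy \<Omega> \<mu> f (u n) - energy \<Omega> \<mu> f ustar)"
proof
  fix n
  let ?L = "lebesgue_on \<Omega>"
  have \<Omega>: "open \<Omega>" "\<Omega> \<noteq> {}" using domain by (auto simp: bounded_lipschitz_domain_def)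
  obtain m M where m: "m > 0" and A2': "\<And>x s t. x \<in> closure \<Omega> \<Longrightarrow> 0 \<le> s \<Longrightarrow> s \<le> t \<Longrightarrow>
        m * (t - s) \<le> \<mu> x (t\<^sup>2) * t - \<mu> x (s\<^sup>2) * s \<and> \<mu> x (t\<^sup>2) * t - \<mu> x (s\<^sup>2) * s \<le> M * (t - s)"
    using A2 unfolding visc_A2_def by metis
  have profile: "viscosity_profile (\<mu> x) m" if "x \<in> closure \<Omega>" for x
    using A1 A3 A2'[OF that] that by unfold_locales (auto simp: visc_A1_def visc_A3_def)
  \<comment> \<open>(A2) between \<open>0\<close> and \<open>sqrt t\<close> bounds
    \<open>\<mu> x t\<close> for \<open>t > 0\<close> only; a right limit supplies
    \<open>t = 0\<close>, and monotonicity then gives all \<open>t\<close>.\<close>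
  have le_M: "\<mu> x t \<le> M" if x: "x \<in> closure \<Omega>" and t: "t \<ge> 0" for x t
  proof -
    interpret viscosity_profile "\<mu> x" m by (rule profile[OF x])
    have "((\<lambda>t. \<mu> x t) \<longlongrightarrow> \<mu> x 0) (at 0 within {0..})"
      using cont by (auto simp: continuous_on_def)
    then have "(\<mu> x \<longlongrightarrow> \<mu> x 0) (at_right 0)" by (rule tendsto_within_subset) auto
    moreover have "\<forall>\<^sub>F t in at_right 0. \<mu> x t \<le> M"
    proof (rule eventually_at_right_less[THEN eventually_mono])
      fix t :: real assume "0 < t"
      then show "\<mu> x t \<le> M" using A2'[OF x, of 0 "sqrt t"] by simp
    qed
    ultimately have "\<mu> x 0 \<le> M" by (intro tendsto_upperbound) auto
    then show ?thesis using antimono[of 0 t] t by simp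
  qed
  note cl = subsetD[OF closure_subset, of _ \<Omega>]

  define e0 e1 es where "e0 = sym_grad \<Omega> (u n)" and "e1 = sym_grad \<Omega> (u (Suc n))"
    and "es = sym_grad \<Omega> ustar"
  define a where "a x = \<mu> x ((norm (e0 x))\<^sup>2)" for x
  define pot where "pot e x = \<phi>_pot \<mu> x ((norm (e x))\<^sup>2)" for e :: "real^'n \<Rightarrow> real^'n^'n" and x
  define F where "F v = (LINT x|?L. f x \<bullet> v x)" for v
  have uV: "u k \<in> V_space \<Omega>" for k using u by (cases k) (auto simp: kacanov_iteration_def)
  have sV: "ustar \<in> V_space \<Omega>" using ustar by (simp add: is_minimiser_def)
  have eL2: "e0 \<in> L2 \<Omega>" "e1 \<in> L2 \<Omega>" "es \<in> L2 \<Omega>"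
    unfolding e0_def e1_def es_def by (intro sym_grad_L2 uV sV)+
  have normsq: "(\<lambda>x. (x, (norm (e x))\<^sup>2)) \<in> borel_measurable ?L" if "e \<in> L2 \<Omega>"
    for e :: "real^'n \<Rightarrow> real^'n^'n"
  proof (rule borel_measurable_Pair)
    show "(\<lambda>x. x) \<in> borel_measurable ?L"
      by (intro measurable_restrict_space1 measurable_completion) simp
    show "(\<lambda>x. (norm (e x))\<^sup>2) \<in> borel_measurable ?L"
      using that by (auto simp: L2_def)
  qed
  have into: "(\<lambda>x. (x, (norm (e x))\<^sup>2)) ` space ?L \<subseteq> closure \<Omega> \<times> {0..}"
    for e :: "real^'n \<Rightarrow> real^'n^'n"
    using cl by auto
  have "a \<in> borel_measurable ?L"
    using borel_measurable_continuous_on_comp[OF _ normsq into, of "\<lambda>(x, t). \<mu> x t" e0] A1 eL2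
    by (simp add: a_def[abs_def] visc_A1_def)
  moreover have "\<bar>a x\<bar> \<le> M" if "x \<in> \<Omega>" for x
    using le_M[OF cl[OF that]] viscosity_profile.viscosity_ge[OF profile[OF cl[OF that]], of "(norm (e0 x))\<^sup>2"] m
    by (auto simp: a_def)
  ultimately have int_a: "integrable ?L (\<lambda>x. a x * (e x \<bullet> h x))" if "e \<in> L2 \<Omega>" "h \<in> L2 \<Omega>"
    for e h :: "real^'n \<Rightarrow> real^'n^'n"
    using that by (intro L2_mult_inner_integrable)
  have int_pot: "integrable ?L (pot e)" if e: "e \<in> L2 \<Omega>" for e
  proof (rule Bochner_Integration.integrable_bound)
    show "integrable ?L (\<lambda>x. M * (norm (e x))\<^sup>2)" using e by (auto simp: L2_def)
    show "pot e \<in> borel_measurable ?L"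
      using borel_measurable_continuous_on_comp[OF continuous_on_\<phi>_pot[OF A1] normsq[OF e] into]
      by (simp add: pot_def[abs_def])
    have "0 \<le> pot e x \<and> pot e x \<le> M * (norm (e x))\<^sup>2" if "x \<in> \<Omega>" for x
      unfolding pot_def \<phi>_pot_def
      by (rule viscosity_profile.pot_bounds[OF profile[OF cl[OF that]]])
         (use m le_M[OF cl[OF that]] in auto)
    then show "AE x in ?L. norm (pot e x) \<le> norm (M * (norm (e x))\<^sup>2)"
      by (intro AE_I2) fastforce
  qed
  have E: "energy \<Omega> \<mu> f v = (LINT x|?L. pot (sym_grad \<Omega> v) x) - F v" for v
    by (simp add: energy_def pot_def F_def)
  have weak: "(LINT x|?L. a x * (e1 x \<bullet> sym_grad \<Omega> v x)) = F v" if "v \<in> V_space \<Omega>" for v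
    using u that by (simp add: kacanov_iteration_def a_def e0_def e1_def F_def)

  define k where "k x = (INF t\<in>{-1<..<1}. deriv_nonneg (\<xi>_fun \<mu> x)
          (max 0 (norm (es x) + t * norm (e0 x - es x))))" for x
  have k_pos: "k x \<ge> m" and a_pos: "a x \<ge> m" if "x \<in> \<Omega>" for x
  proof -
    interpret viscosity_profile "\<mu> x" m by (rule profile[OF cl[OF that]])
    show "k x \<ge> m" unfolding k_def \<xi>_fun_def[abs_def] by (rule cINF_greatest) (auto intro: deriv_flux_ge)
    show "a x \<ge> m" unfolding a_def by (rule viscosity_ge) simp
  qed
  define S where "S = esssup ?L (\<lambda>x. ereal (a x / k x))"
  \<comment> \<open>If the essential supremum were infinite, its real part would be \<open>0\<close>, hence \<open>l = 0\<close>; the estimate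
    below covers this case.\<close>
  define l where "l = inverse (real_of_ereal S)"
  have S: "AE x in ?L. ereal (a x / k x) \<le> S" unfolding S_def by (rule esssup_AE)
  \<comment> \<open>Positive measure of \<open>\<Omega>\<close> is what turns the almost everywhere
    bound of the nonnegative quotient by \<open>S\<close> into \<open>S \<ge> 0\<close>.\<close>
  have not_null: "\<not> (AE x in ?L. False)"
  proof
    assume "AE x in ?L. False"
    then have "AE x in lebesgue. x \<notin> \<Omega>"
      using \<Omega> by (subst (asm) AE_restrict_space_iff) (auto simp: borel_open)
    then have "negligible \<Omega>"
      using \<Omega> by (simp add: negligible_iff_null_sets AE_iff_null_sets borel_open)
    then show False using open_not_negligible \<Omega> by blast
  qed
  have S_pos: "S \<ge> 0"
  proof (rule ccontr)
    assume "\<not> S \<ge> 0"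
    have "AE x in ?L. False"
      using S
    proof (rule AE_mp, intro AE_I2 impI)
      fix x assume x: "x \<in> space ?L" "ereal (a x / k x) \<le> S"
      then have "0 \<le> a x / k x" using a_pos k_pos m by (intro divide_nonneg_nonneg) force+
      then show False using x(2) \<open>\<not> S \<ge> 0\<close> by (meson ereal_less_eq(5) order_trans)
    qed
    with not_null show False ..
  qed
  then have l: "l \<ge> 0" by (simp add: l_def real_of_ereal_pos)
  have lk: "AE x in ?L. l * a x \<le> k x"
    using S
  proof (rule AE_mp, intro AE_I2 impI)
    fix x assume "x \<in> space ?L" and le: "ereal (a x / k x) \<le> S"
    then have x: "k x \<ge> m" using k_pos by simp
    \<comment> \<open>For \<open>l = 0\<close> the claim is just \<open>0 \<le> k x\<close>.
      Otherwise \<open>S\<close> is finite and positive, and the bound on the quotient can be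
      cleared of denominators because \<open>k x \<ge> m > 0\<close>.\<close>
    show "l * a x \<le> k x"
    proof (cases "l = 0")
      case False
      then obtain r where r: "S = ereal r" "r > 0" "l = inverse r"
        using S_pos by (cases S) (auto simp: l_def)
      then have "a x \<le> r * k x" using le x m by (simp add: field_simps)
      then show ?thesis using r(2) unfolding r(3) by (simp add: field_simps)
    qed (use x m in simp)
  qed

  have "AE x in ?L. pot e1 x - pot e0 x + l * (pot e0 x - pot es x)
    \<le> a x * (e1 x \<bullet> e1 x) - a x * (e1 x \<bullet> e0 x) + l * (a x * (e1 x \<bullet> e0 x) - a x * (e1 x \<bullet> es x))"
    using lk
  proof (rule AE_mp, intro AE_I2 impI)
    fix x assume "x \<in> space ?L" "l * a x \<le> k x"
    then show "pot e1 x - pot e0 x + l * (pot e0 x - pot es x)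
      \<le> a x * (e1 x \<bullet> e1 x) - a x * (e1 x \<bullet> e0 x) + l * (a x * (e1 x \<bullet> e0 x) - a x * (e1 x \<bullet> es x))"
      using viscosity_profile.kacanov_pointwise[OF profile[OF cl] m l, of x "e0 x" "es x" "e1 x"]
      by (simp add: pot_def \<phi>_pot_def a_def k_def \<xi>_fun_def[abs_def])
  qed
  then have "(LINT x|?L. pot e1 x - pot e0 x + l * (pot e0 x - pot es x))
    \<le> (LINT x|?L. a x * (e1 x \<bullet> e1 x) - a x * (e1 x \<bullet> e0 x) + l * (a x * (e1 x \<bullet> e0 x) - a x * (e1 x \<bullet> es x)))"
    by (intro integral_mono_AE Bochner_Integration.integrable_add Bochner_Integration.integrable_diff
        integrable_mult_right int_pot int_a eL2)
  \<comment> \<open>The iteration equation turns the integrals on the right into values of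
    \<open>F\<close>, which cancel the load terms of the energies on the left.\<close>
  then have "energy \<Omega> \<mu> f (u (Suc n)) - energy \<Omega> \<mu> f (u n)
      + l * (energy \<Omega> \<mu> f (u n) - energy \<Omega> \<mu> f ustar) \<le> 0"
    using weak[OF uV[of "Suc n"]] weak[OF uV[of n]] weak[OF sV]
    by (simp add: int_pot int_a eL2 E e0_def[symmetric] e1_def[symmetric] es_def[symmetric] algebra_simps)
  moreover have min: "energy \<Omega> \<mu> f (u k) - energy \<Omega> \<mu> f ustar \<ge> 0" for k
    using ustar uV by (simp add: is_minimiser_def)
  \<comment> \<open>Nonnegativity of this term relaxes the factor \<open>1 - l\<close> to
    \<open>1 - l / 4\<close>.\<close>
  moreover have "0 \<le> l * (energy \<Omega> \<mu> f (u n) - energy \<Omega> \<mu> f ustar)"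
    using l min by simp
  moreover have cf: "contraction_factor \<Omega> \<mu> ustar (u n) = 1 - 1/4 * l"
    by (simp add: contraction_factor_def l_def S_def a_def k_def e0_def es_def)
  ultimately show "0 \<le> energy \<Omega> \<mu> f (u (Suc n)) - energy \<Omega> \<mu> f ustar \<and>
             energy \<Omega> \<mu> f (u (Suc n)) - energy \<Omega> \<mu> f ustar
               \<le> contraction_factor \<Omega> \<mu> ustar (u n) * (energy \<Omega> \<mu> f (u n) - energy \<Omega> \<mu> f ustar)"
    using min[of "Suc n"] unfolding cf left_diff_distrib mult_1 mult.assoc by linarith
qed

end
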